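(* Let $n\ge 2$, $\alpha\ge 1$, $M\ge 1$ be integers. For any optimal reconstructing distributed storage scheme (ORDSS) over the unidirectional ring network with parameters $(n,\alpha,M)$ and any storage node $N_i$, $1\le i\le n$, that fails, every repair protocol that repairs $N_i$ has repair bandwidth at least $M$.
   Context: Unidirectional ring network with parameters $(n,\alpha,M)$: there are $n$ storage nodes $N_1,\dots,N_n$ (indices modulo $n$) forming a directed ring; data can be sent only along the edges $N_j\to N_{j-1}$ (in particular $N_1\to N_n$). For each $i$ there is one user $U_i$, connected only to $N_i$ by an edge $N_i\to U_i$. The original data is a row vector $X\in\mathbb{F}_q^M$ of $M$ symbols over a finite field $\mathbb{F}_q$. Storage scheme (linear): a choice of a finite field $\mathbb{F}_q$ and of matrices $G^{(i)}\in\mathbb{F}_q^{M\times\alpha}$, $1\le i\le n$ (node generator matrices), such that the generator matrix $G=[G^{(1)},\dots,G^{(n)}]\in\mathbb{F}_q^{M\times n\alpha}$ has full row rank $M$. Node $N_i$ stores the $\alpha$ coordinates of $XG^{(i)}$; the $\alpha$ columns of $G^{(i)}$ are called the node vectors of $N_i$. Reconstruction protocol for user $U_i$: a finite sequence of transmissions, each sending one symbol of $\mathbb{F}_q$ along an edge $N_j\to N_{j-1}$ of the ring or along $N_i\to U_i$. A symbol sent by $N_j$ is a fixed $\mathbb{F}_q$-linear combination of the symbols stored at $N_j$ and the symbols previously received by $N_j$; it thus corresponds to a transmitted vector in $\mathbb{F}_q^M$, the same linear combination of the corresponding vectors. User $U_i$ recovers (reconstructs) the original data if the vectors it receives span $\mathbb{F}_q^M$.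 The reconstructing bandwidth is the total number of symbols transmitted over all edges, including the edge $N_i\to U_i$. ORDSS: a storage scheme in which every user $U_i$, $1\le i\le n$, can recover the original data with reconstructing bandwidth exactly $kM-\frac{(k-1)k\alpha}{2}$, where $k=\lceil M/\alpha\rceil$ (this is the minimum possible reconstructing bandwidth). Repair: when $N_i$ fails, it is replaced by a new node $N_i'$ that takes its place in the ring (it receives from $N_{i+1}$ and sends to $N_{i-1}$) and initially stores nothing. A repair protocol is a finite sequence of transmissions of single symbols along the ring edges, each being a linear combination of the symbols stored at the sending node and those it previously received. It repairs $N_i$ if $N_i'$ can recover, by linear combinations of the symbols it receives, all $\alpha$ symbols formerly stored at $N_i$, i.e. all $\alpha$ node vectors of $N_i$ lie in the span of the vectors received by $N_i'$. The repair bandwidth is the total number of symbols transmitted over all edges. *)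

theory Defs
  imports Complex_Main "Jordan_Normal_Form.DL_Rank"
begin

text \<open>Nodes and users are indexed by \<open>0, \<dots>, n - 1\<close>, so \<open>Node i\<close> is the (i+1)-st node of the ring.
  Scalars range over an arbitrary finite field \<open>'q\<close>; vectors are elements of \<open>carrier_vec M\<close>.\<close>

datatype vertex = Node nat | User nat

type_synonym edge = "vertex \<times> vertex"

definition ring_edges :: "nat \<Rightarrow> edge set" where
  "ring_edges n = {(Node j, Node ((j + n - 1) mod n)) | j. j < n}"

definition vspan :: "nat \<Rightarrow> 'q::field vec set \<Rightarrow> 'q vec set" where
  "vspan M S = LinearCombinations.module.span class_ring (module_vec TYPE('q) M) S"


definition generator_matrix :: "nat \<Rightarrow> nat \<Rightarrow> (nat \<Rightarrow> 'q::field mat) \<Rightarrow> 'q mat" where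
  "generator_matrix n M G = mat_of_cols M (concat (map (\<lambda>i. cols (G i)) [0..<n]))"

definition storage_scheme :: "nat \<Rightarrow> nat \<Rightarrow> nat \<Rightarrow> (nat \<Rightarrow> 'q::{field,finite} mat) \<Rightarrow> bool" where
  "storage_scheme n \<alpha> M G \<longleftrightarrow>
     (\<forall>i<n. G i \<in> carrier_mat M \<alpha>) \<and> vec_space.rank M (generator_matrix n M G) = M"

definition node_vectors :: "(nat \<Rightarrow> 'q::field mat) \<Rightarrow> nat \<Rightarrow> 'q vec set" where
  "node_vectors G i = set (cols (G i))"

definition stored :: "(nat \<Rightarrow> 'q::field mat) \<Rightarrow> vertex \<Rightarrow> 'q vec set" where
  "stored G v = (case v of Node j \<Rightarrow> node_vectors G j | User _ \<Rightarrow> {})"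


text \<open>A symbol in transit is represented by its vector \<open>x\<close>: the symbol is the product of the data
  row vector with the column \<open>x\<close>. A transmission \<open>(u, v, x)\<close> sends this symbol from \<open>u\<close> to \<open>v\<close>.\<close>

type_synonym 'q transmission = "vertex \<times> vertex \<times> 'q vec"

type_synonym 'q protocol = "'q transmission list"

definition received :: "'q protocol \<Rightarrow> vertex \<Rightarrow> 'q vec set" where
  "received P v = {x. \<exists>u. (u, v, x) \<in> set P}"

text \<open>\<open>E\<close> is the set of usable edges and \<open>S v\<close> the set of vectors initially stored at \<open>v\<close>.\<close>

definition is_protocol ::
  "nat \<Rightarrow> edge set \<Rightarrow> (vertex \<Rightarrow> 'q::field vec set) \<Rightarrow> 'q protocol \<Rightarrow> bool" where
  "is_protocol M E S P \<longleftrightarrow>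
     (\<forall>t<length P. \<forall>u v x. P ! t = (u, v, x) \<longrightarrow>
        (u, v) \<in> E \<and> x \<in> vspan M (S u \<union> received (take t P) u))"

definition bandwidth :: "'q protocol \<Rightarrow> nat" where
  "bandwidth P = length P"


definition reconstruction_protocol ::
  "nat \<Rightarrow> nat \<Rightarrow> (nat \<Rightarrow> 'q::field mat) \<Rightarrow> nat \<Rightarrow> 'q protocol \<Rightarrow> bool" where
  "reconstruction_protocol n M G i P \<longleftrightarrow>
     is_protocol M (insert (Node i, User i) (ring_edges n)) (stored G) P"

definition recovers :: "nat \<Rightarrow> nat \<Rightarrow> 'q::field protocol \<Rightarrow> bool" where
  "recovers M i P \<longleftrightarrow> vspan M (received P (User i)) = carrier_vec M"

definition ORDSS :: "nat \<Rightarrow> nat \<Rightarrow> nat \<Rightarrow> (nat \<Rightarrow> 'q::{field,finite} mat) \<Rightarrow> bool" where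
  "ORDSS n \<alpha> M G \<longleftrightarrow> storage_scheme n \<alpha> M G \<and>
     (\<forall>i<n. \<exists>P. reconstruction_protocol n M G i P \<and> recovers M i P \<and>
        (let k = real_of_int \<lceil>real M / real \<alpha>\<rceil>
         in real (bandwidth P) = k * real M - (k - 1) * k * real \<alpha> / 2))"


text \<open>The replacement of the failed node \<open>i\<close> is again called \<open>Node i\<close>, but stores nothing.\<close>

definition repair_protocol ::
  "nat \<Rightarrow> nat \<Rightarrow> (nat \<Rightarrow> 'q::field mat) \<Rightarrow> nat \<Rightarrow> 'q protocol \<Rightarrow> bool" where
  "repair_protocol n M G i P \<longleftrightarrow>
     is_protocol M (ring_edges n) ((stored G)(Node i := {})) P"

definition repairs :: "nat \<Rightarrow> (nat \<Rightarrow> 'q::field mat) \<Rightarrow> nat \<Rightarrow> 'q protocol \<Rightarrow> bool" where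
  "repairs M G i P \<longleftrightarrow> node_vectors G i \<subseteq> vspan M (received P (Node i))"

end

theory Submission
  imports Defs "HOL-Number_Theory.Cong"
begin

text \<open>Everything that reaches \<open>U\<^sub>i\<close> or \<open>N\<^sub>i\<close> passes through the chain of receivers
  \<open>U\<^sub>i, N\<^sub>i, N\<^sub>i\<^sub>+\<^sub>1, \<dots>\<close>. Let \<open>c\<^sub>l\<close> be the number of symbols received by its \<open>l\<close>-th member.
  In a reconstruction protocol, the at most \<open>l \<alpha>\<close> vectors of \<open>N\<^sub>i, \<dots>, N\<^sub>i\<^sub>+\<^sub>l\<^sub>-\<^sub>1\<close> and the \<open>c\<^sub>l\<close>
  received ones span the whole space, so \<open>c\<^sub>l \<ge> M - l \<alpha>\<close>. The optimal bandwidth is the sum of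
  these bounds for \<open>l < \<lceil>M / \<alpha>\<rceil>\<close>, so all of them are tight; hence the node vectors of \<open>l\<close> consecutive
  nodes span a space of dimension at least \<open>min M (l \<alpha>)\<close>. In a repair protocol for \<open>N\<^sub>i\<close>,
  the same cut shows that the vectors of
  \<open>N\<^sub>i\<^sub>+\<^sub>1, \<dots>, N\<^sub>i\<^sub>+\<^sub>l\<^sub>-\<^sub>1\<close> together with the \<open>c\<^sub>l\<close> received ones span those of
  \<open>N\<^sub>i, \<dots>, N\<^sub>i\<^sub>+\<^sub>l\<^sub>-\<^sub>1\<close>, so \<open>c\<^sub>l \<ge> min M (l \<alpha>) - (l - 1) \<alpha>\<close>, and these bounds telescope to \<open>M\<close>.
  A dimension bound is expressed below as a lower bound on the cardinality of every spanning set.\<close>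

section \<open>Linear spans and spanning sets\<close>

lemma vspan_mono: "S \<subseteq> T \<Longrightarrow> vspan M S \<subseteq> vspan M (T :: 'a::field vec set)"
proof -
  interpret vec_space "TYPE('a)" M .
  show "S \<subseteq> T \<Longrightarrow> vspan M S \<subseteq> vspan M T"
    unfolding vspan_def by (rule span_is_monotone)
qed

lemma vspan_superset:
  assumes "S \<subseteq> carrier_vec M"
  shows "S \<subseteq> vspan M S"
proof -
  interpret vec_space "TYPE('a)" M .
  show ?thesis using assms unfolding vspan_def by (rule in_own_span)
qed

lemma vspan_carrier:
  assumes "S \<subseteq> carrier_vec M"
  shows "vspan M S \<subseteq> carrier_vec M"
proof -
  interpret vec_space "TYPE('a)" M .
  show ?thesis using assms unfolding vspan_def by (rule span_is_subset2)
qed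

lemma vspan_subset:
  assumes "S \<subseteq> vspan M T" "T \<subseteq> carrier_vec M"
  shows "vspan M S \<subseteq> vspan M T"
proof -
  interpret vec_space "TYPE('a)" M .
  show ?thesis using assms unfolding vspan_def
    by (simp add: span_is_submodule span_is_subset)
qed

lemma card_vspan_ge:
  assumes "finite T" "T \<subseteq> carrier_vec M" "carrier_vec M \<subseteq> vspan M (T :: 'a::field vec set)"
  shows "M \<le> card T"
proof -
  interpret vec_space "TYPE('a)" M .
  have "span T = carrier_vec M"
    using vspan_carrier[OF assms(2)] assms(3) unfolding vspan_def by auto
  then show ?thesis using gen_ge_dim[of T] assms dim_is_n by simp
qed

section \<open>Counting symbols at each receiver\<close>

text \<open>Counted with multiplicity, whereas the set \<open>received P v\<close> merges equal
  vectors; only this count adds up to the bandwidth.\<close>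

definition num_received :: "'q protocol \<Rightarrow> vertex \<Rightarrow> nat" where
  "num_received P v = length (filter (\<lambda>(u, w, x). w = v) P)"

lemma received_eq_set: "received P v = set (map (\<lambda>(u, w, x). x) (filter (\<lambda>(u, w, x). w = v) P))"
  unfolding received_def by force

lemma finite_received: "finite (received P v)"
  unfolding received_eq_set by simp

lemma card_received_le: "card (received P v) \<le> num_received P v"
  unfolding received_eq_set num_received_def by (metis card_length length_map)

lemma sum_num_received_le:
  assumes "finite V"
  shows "(\<Sum>v\<in>V. num_received P v) \<le> bandwidth P"
proof (induction P)
  case Nil
  then show ?case by (simp add: num_received_def bandwidth_def)
next
  case (Cons p P)
  obtain u w x where p: "p = (u, w, x)" by (cases p)
  have "num_received (p # P) v = (if w = v then 1 else 0) + num_received P v" for v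
    by (simp add: num_received_def p)
  then have "(\<Sum>v\<in>V. num_received (p # P) v) =
      (\<Sum>v\<in>V. if w = v then 1 else 0) + (\<Sum>v\<in>V. num_received P v)"
    by (simp add: sum.distrib)
  also have "\<dots> \<le> 1 + bandwidth P"
    using Cons.IH assms by (simp add: sum.delta')
  finally show ?case by (simp add: bandwidth_def)
qed

section \<open>Cuts in a protocol\<close>

lemma is_protocol_mono: "is_protocol M E S P \<Longrightarrow> E \<subseteq> F \<Longrightarrow> is_protocol M F S P"
  unfolding is_protocol_def by blast

lemma is_protocol_edge: "is_protocol M E S P \<Longrightarrow> (u, v, x) \<in> set P \<Longrightarrow> (u, v) \<in> E"
  unfolding is_protocol_def in_set_conv_nth by blast

text \<open>Induction on time: a vector sent inside \<open>A\<close> combines stored and earlier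
  received vectors, all in the span already, and one entering \<open>A\<close> is covered by
  \<open>cut\<close>.\<close>

lemma protocol_cut:
  assumes P: "is_protocol M E S P" and B: "B \<subseteq> carrier_vec M"
    and S: "\<And>v. v \<in> A \<Longrightarrow> S v \<subseteq> vspan M B"
    and cut: "\<And>u v x. (u, v, x) \<in> set P \<Longrightarrow> v \<in> A \<Longrightarrow> u \<notin> A \<Longrightarrow> x \<in> vspan M B"
    and "v \<in> A"
  shows "received P v \<subseteq> vspan M B"
proof -
  have "received (take t P) v \<subseteq> vspan M B" if "t \<le> length P" "v \<in> A" for t v
    using that
  proof (induction t arbitrary: v)
    case 0
    then show ?case by (simp add: received_def)
  next
    case (Suc t)
    obtain u w x where p: "P ! t = (u, w, x)" by (cases "P ! t")
    have t: "take (Suc t) P = take t P @ [(u, w, x)]"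
      using Suc.prems p by (simp add: take_Suc_conv_app_nth)
    have "x \<in> vspan M B" if "w \<in> A"
    proof (cases "u \<in> A")
      case True
      have "x \<in> vspan M (S u \<union> received (take t P) u)"
        using P p Suc.prems unfolding is_protocol_def by auto
      moreover have "S u \<union> received (take t P) u \<subseteq> vspan M B"
        using S[OF True] Suc.IH[OF _ True] Suc.prems by simp
      ultimately show ?thesis using vspan_subset[OF _ B] by blast
    next
      case False
      have "(u, w, x) \<in> set P" using p Suc.prems by (metis Suc_le_lessD nth_mem)
      then show ?thesis using cut that False by blast
    qed
    then show ?case using Suc.IH[of v] Suc.prems unfolding t received_def by auto
  qed
  from this[of "length P" v] show ?thesis using \<open>v \<in> A\<close> by simp
qed

text \<open>The ring together with \<open>User i\<close> is closed under the edges, so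
  \<open>protocol_cut\<close> applies with nothing entering from outside.\<close>

lemma received_carrier:
  assumes P: "is_protocol M (insert (Node i, User i) (ring_edges n)) S P"
    and "i < n" "S (User i) = {}"
    and S: "\<And>j. j < n \<Longrightarrow> S (Node j) \<subseteq> carrier_vec M"
  shows "received P v \<subseteq> carrier_vec M"
proof -
  define A where "A = insert (User i) (Node ` {..<n})"
  have E: "u \<in> A \<and> w \<in> A" if "(u, w, x) \<in> set P" for u w x
    using is_protocol_edge[OF P that] \<open>i < n\<close> by (auto simp: A_def ring_edges_def)
  have "S v \<subseteq> vspan M (carrier_vec M)" if "v \<in> A" for v
    using that assms(3) S vspan_superset[of "carrier_vec M" M] by (fastforce simp: A_def)
  then have *: "received P v \<subseteq> vspan M (carrier_vec M)" if "v \<in> A"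
    using that E by (intro protocol_cut[OF P, where A = A]) blast+
  show ?thesis
  proof (cases "v \<in> A")
    case True
    then show ?thesis using * vspan_carrier[of "carrier_vec M" M] by blast
  next
    case False
    then show ?thesis using E unfolding received_def by blast
  qed
qed

section \<open>The chain of receivers on the ring\<close>

text \<open>The user has index 0, so the members up to index \<open>l\<close> contain exactly the
  nodes that \<open>window n G i l\<close> covers.\<close>

fun receiver :: "nat \<Rightarrow> nat \<Rightarrow> nat \<Rightarrow> vertex" where
  "receiver n i 0 = User i"
| "receiver n i (Suc m) = Node ((i + m) mod n)"

lemma add_mod_inj:
  fixes i :: nat
  assumes "(i + a) mod n = (i + b) mod n" "a < n" "b < n"
  shows "a = b"
  using assms by (metis cong_add_lcancel_nat cong_def cong_less_modulus_unique_nat)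

lemma inj_on_receiver: "inj_on (receiver n i) {..n}"
proof (rule inj_onI)
  fix a b assume "a \<in> {..n}" "b \<in> {..n}" "receiver n i a = receiver n i b"
  then show "a = b" using add_mod_inj[of i "a - 1" n "b - 1"] by (cases a; cases b) auto
qed

lemma sum_receiver_le:
  "I \<subseteq> {..n} \<Longrightarrow> (\<Sum>l\<in>I. num_received P (receiver n i l)) \<le> bandwidth P"
  using sum_num_received_le[of "receiver n i ` I" P] inj_on_subset[OF inj_on_receiver]
  by (simp add: sum.reindex finite_subset[of I "{..n}"])

lemma ring_edge_mod:
  assumes "(u, Node ((i + m) mod n)) \<in> ring_edges n"
  shows "u = Node ((i + Suc m) mod n)"
proof -
  obtain j where j: "u = Node j" "j < n" "(j + n - 1) mod n = (i + m) mod n"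
    using assms by (auto simp: ring_edges_def)
  have "Suc (j + n - 1) mod n = Suc (i + m) mod n"
    using j(3) by (metis mod_Suc_eq)
  then show ?thesis using j by simp
qed

text \<open>Symbols enter the first members of the chain only at the last of them, whose received
  vectors are therefore added to \<open>T\<close>. Reconstruction uses \<open>l' = 0\<close>, repair
  \<open>l' = 1\<close>.\<close>

lemma ring_cut:
  assumes P: "is_protocol M (insert (Node i, User i) (ring_edges n)) S P"
    and "i < n" "S (User i) = {}"
    and S: "\<And>j. j < n \<Longrightarrow> S (Node j) \<subseteq> carrier_vec M"
    and T: "T \<subseteq> carrier_vec M" "\<And>m. m < l \<Longrightarrow> S (Node ((i + m) mod n)) \<subseteq> vspan M T"
    and l: "l' \<le> l" "l' \<le> 1"
  shows "received P (receiver n i l') \<subseteq> vspan M (T \<union> received P (receiver n i l))"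
proof -
  define B where "B = T \<union> received P (receiver n i l)"
  have B: "B \<subseteq> carrier_vec M"
    using T received_carrier[OF P \<open>i < n\<close> assms(3) S] by (simp add: B_def)
  show ?thesis unfolding B_def[symmetric]
  proof (rule protocol_cut[OF P B, where A = "receiver n i ` {..l}"])
    show "receiver n i l' \<in> receiver n i ` {..l}"
      using l by simp
  next
    fix v assume "v \<in> receiver n i ` {..l}"
    then obtain a where a: "a \<le> l" "v = receiver n i a" by auto
    then have "S v \<subseteq> vspan M T" using assms(3) T(2) by (cases a) auto
    then show "S v \<subseteq> vspan M B" using vspan_mono[of T B M] by (auto simp: B_def)
  next
    fix u v x
    assume p: "(u, v, x) \<in> set P" "v \<in> receiver n i ` {..l}" "u \<notin> receiver n i ` {..l}"
    obtain a where a: "a \<le> l" "v = receiver n i a" using p by auto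
    have "u = receiver n i (Suc a)"
    proof (cases a)
      case 0
      then show ?thesis using is_protocol_edge[OF P p(1)] a \<open>i < n\<close>
        by (auto simp: ring_edges_def)
    next
      case (Suc m)
      then show ?thesis using is_protocol_edge[OF P p(1)] a ring_edge_mod[of u i m n] by auto
    qed
    \<comment> \<open>For \<open>a < l\<close> the sender, being the next member, would still lie
      inside the cut.\<close>
    then have "a = l" using p(3) a(1) by (metis Suc_leI atMost_iff imageI le_neq_implies_less)
    then have "x \<in> B" using p(1) a(2) by (auto simp: B_def received_def)
    then show "x \<in> vspan M B" using vspan_superset[OF B] by blast
  qed
qed

section \<open>Windows of consecutive nodes\<close>

definition window :: "nat \<Rightarrow> (nat \<Rightarrow> 'q::field mat) \<Rightarrow> nat \<Rightarrow> nat \<Rightarrow> 'q vec set" where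
  "window n G i l = (\<Union>m<l. node_vectors G ((i + m) mod n))"

lemma node_vectors_carrier: "G j \<in> carrier_mat M \<alpha> \<Longrightarrow> node_vectors G j \<subseteq> carrier_vec M"
  unfolding node_vectors_def using cols_dim by blast

lemma finite_window: "finite (window n G i l)"
  by (simp add: window_def node_vectors_def)

lemma window_carrier:
  assumes "\<And>j. j < n \<Longrightarrow> G j \<in> carrier_mat M \<alpha>" "0 < n"
  shows "window n G i l \<subseteq> carrier_vec M"
proof -
  have "node_vectors G ((i + m) mod n) \<subseteq> carrier_vec M" for m
    using assms by (intro node_vectors_carrier[of _ _ _ \<alpha>]) simp
  then show ?thesis unfolding window_def by blast
qed

lemma card_window_le:
  assumes "\<And>j. j < n \<Longrightarrow> G j \<in> carrier_mat M \<alpha>" "0 < n"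
  shows "card (window n G i l) \<le> l * \<alpha>"
proof -
  have "card (node_vectors G ((i + m) mod n)) \<le> \<alpha>" for m
    using card_length[of "cols (G ((i + m) mod n))"] assms
    by (metis carrier_matD(2) cols_length mod_less_divisor node_vectors_def)
  then have "card (window n G i l) \<le> (\<Sum>m<l. \<alpha>)"
    unfolding window_def by (intro order.trans[OF card_UN_le] sum_mono) simp_all
  then show ?thesis by simp
qed

section \<open>Bounds from reconstruction\<close>

text \<open>\<open>T\<close> is left arbitrary for two uses: the window itself bounds the received
  symbols from below, and once that bound is tight, any other \<open>T\<close> yields the dimension
  bound.\<close>

lemma reconstruction_card_ge:
  assumes P: "reconstruction_protocol n M G i P" "recovers M i P"
    and G: "\<And>j. j < n \<Longrightarrow> G j \<in> carrier_mat M \<alpha>" and "i < n"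
    and T: "finite T" "T \<subseteq> carrier_vec M" "window n G i l \<subseteq> vspan M T"
  shows "M \<le> card T + num_received P (receiver n i l)"
proof -
  let ?R = "received P (receiver n i l)"
  have P': "is_protocol M (insert (Node i, User i) (ring_edges n)) (stored G) P"
    using P(1) unfolding reconstruction_protocol_def .
  have S: "stored G (User i) = {}" "\<And>j. j < n \<Longrightarrow> stored G (Node j) \<subseteq> carrier_vec M"
    using node_vectors_carrier[OF G] by (auto simp: stored_def)
  have R: "T \<union> ?R \<subseteq> carrier_vec M"
    using T(2) received_carrier[OF P' \<open>i < n\<close> S] by simp
  have "stored G (Node ((i + m) mod n)) \<subseteq> vspan M T" if "m < l" for m
    using that T(3) by (auto simp: stored_def window_def)
  from ring_cut[OF P' \<open>i < n\<close> S T(2) this, of l 0]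
  have "received P (User i) \<subseteq> vspan M (T \<union> ?R)" by simp
  then have "carrier_vec M \<subseteq> vspan M (T \<union> ?R)"
    using vspan_subset[OF _ R] P(2) unfolding recovers_def by blast
  then have "M \<le> card (T \<union> ?R)"
    using T(1) finite_received by (intro card_vspan_ge[OF _ R]) auto
  also have "\<dots> \<le> card T + card ?R" by (rule card_Un_le)
  finally show ?thesis using card_received_le[of P "receiver n i l"] by linarith
qed

text \<open>No edge enters the whole ring, so the stored vectors alone must span the space. This
  later gives \<open>k \<le> n\<close>, which keeps the chain free of repetitions.\<close>

lemma data_le_total_storage:
  assumes P: "reconstruction_protocol n M G i P" "recovers M i P"
    and G: "\<And>j. j < n \<Longrightarrow> G j \<in> carrier_mat M \<alpha>" and "i < n"
  shows "M \<le> n * \<alpha>"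
proof -
  let ?T = "window n G i n"
  have P': "is_protocol M (insert (Node i, User i) (ring_edges n)) (stored G) P"
    using P(1) unfolding reconstruction_protocol_def .
  have T: "?T \<subseteq> carrier_vec M"
    using window_carrier[of n G M \<alpha>] G \<open>i < n\<close> by simp
  have stored: "stored G (Node j) \<subseteq> vspan M ?T" if "j < n" for j
  proof -
    \<comment> \<open>The witness is the cyclic distance from \<open>i\<close> to
      \<open>j\<close>.\<close>
    have "(i + (if i \<le> j then j - i else j + n - i)) mod n = j" using that \<open>i < n\<close> by simp
    moreover have "(if i \<le> j then j - i else j + n - i) < n" using that \<open>i < n\<close> by auto
    ultimately have "node_vectors G j \<subseteq> ?T" unfolding window_def by fastforce
    then show ?thesis using vspan_superset[OF T] by (auto simp: stored_def)
  qed
  have "received P (User i) \<subseteq> vspan M ?T"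
  proof (rule protocol_cut[OF P' T, where A = "insert (User i) (Node ` {..<n})"])
    show "stored G v \<subseteq> vspan M ?T" if "v \<in> insert (User i) (Node ` {..<n})" for v
    proof (cases v)
      case (Node j)
      then show ?thesis using that stored[of j] by auto
    qed (simp add: stored_def)
    show "x \<in> vspan M ?T" if "(u, v, x) \<in> set P" "u \<notin> insert (User i) (Node ` {..<n})" for u v x
      using is_protocol_edge[OF P' that(1)] that(2) \<open>i < n\<close> by (auto simp: ring_edges_def)
  qed simp
  then have "carrier_vec M \<subseteq> vspan M ?T"
    using vspan_subset[OF _ T] P(2) unfolding recovers_def by blast
  then have "M \<le> card ?T" by (rule card_vspan_ge[OF finite_window T])
  then show ?thesis using card_window_le[of n G M \<alpha> i n] G \<open>i < n\<close> by fastforce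
qed

text \<open>An arithmetic series: the assumption rules out truncation in the natural
  subtraction.\<close>

lemma sum_diff_mult:
  fixes M \<alpha> k :: nat
  assumes "k = 0 \<or> (k - 1) * \<alpha> \<le> M"
  shows "real (\<Sum>l<k. M - l * \<alpha>) = real k * real M - (real k - 1) * real k * real \<alpha> / 2"
  using assms
proof (induction k)
  case 0
  then show ?case by simp
next
  case (Suc k)
  then have "k * \<alpha> \<le> M" by simp
  moreover from this have "k = 0 \<or> (k - 1) * \<alpha> \<le> M" by (auto simp: diff_mult_distrib)
  ultimately show ?case using Suc.IH by (simp add: of_nat_diff field_simps)
qed

text \<open>Each summand is the increment of \<open>min M (m * \<alpha>)\<close> from
  \<open>m\<close> to \<open>Suc m\<close>; truncation makes it zero once
  \<open>M \<le> m * \<alpha>\<close>.\<close>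

lemma sum_min_diff_ge: "min M (k * \<alpha>) \<le> (\<Sum>m<k. min M (Suc m * \<alpha>) - m * \<alpha>)" for M \<alpha> k :: nat
  by (induction k) (auto simp: min_def split: if_splits)

lemma optimal_window_card_ge:
  assumes P: "reconstruction_protocol n M G i P" "recovers M i P"
    and G: "\<And>j. j < n \<Longrightarrow> G j \<in> carrier_mat M \<alpha>" and "i < n"
    and k: "M \<le> k * \<alpha>" "k \<le> n"
    and bw: "bandwidth P = (\<Sum>l<k. M - l * \<alpha>)"
    and T: "finite T" "T \<subseteq> carrier_vec M" "window n G i l \<subseteq> vspan M T"
    and "l \<le> k"
  shows "min M (l * \<alpha>) \<le> card T"
proof -
  let ?c = "\<lambda>l. num_received P (receiver n i l)"
  have ge: "M - l * \<alpha> \<le> ?c l" for l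
  proof -
    have W: "window n G i l \<subseteq> carrier_vec M" "card (window n G i l) \<le> l * \<alpha>"
      using window_carrier[of n G M \<alpha>] card_window_le[of n G M \<alpha>] G \<open>i < n\<close> by auto
    show ?thesis
      using reconstruction_card_ge[OF P G \<open>i < n\<close> finite_window W(1) vspan_superset[OF W(1)]] W(2)
      by linarith
  qed
  have "(\<Sum>l\<le>k. ?c l) \<le> (\<Sum>l<k. M - l * \<alpha>)"
    using sum_receiver_le[of "{..k}" n P i] k bw by simp
  \<comment> \<open>The added term for \<open>l = k\<close> vanishes; including it covers the window
    of \<open>k\<close> nodes as well.\<close>
  also have "\<dots> = (\<Sum>l\<le>k. M - l * \<alpha>)"
    using k by (simp add: lessThan_Suc_atMost[symmetric])
  finally have "(\<Sum>l\<le>k. M - l * \<alpha>) = (\<Sum>l\<le>k. ?c l)"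
    using ge by (meson antisym sum_mono)
  \<comment> \<open>Termwise inequalities with equal sums are equalities.\<close>
  then have "M - l * \<alpha> = ?c l"
    by (rule sum_mono_inv) (use ge \<open>l \<le> k\<close> in auto)
  then show ?thesis using reconstruction_card_ge[OF P G \<open>i < n\<close> T] by simp
qed

section \<open>Bounds from repair and the conclusion\<close>

text \<open>The replacement stores nothing, so only \<open>m\<close> of the \<open>Suc m\<close>
  nodes in the window contribute stored vectors; the received ones must supply the rest of its
  dimension, at least \<open>w\<close>.\<close>

lemma repair_received_ge:
  assumes P: "repair_protocol n M G i P" "repairs M G i P"
    and G: "\<And>j. j < n \<Longrightarrow> G j \<in> carrier_mat M \<alpha>" and "i < n" "m < n"
    and W: "\<And>T. finite T \<Longrightarrow> T \<subseteq> carrier_vec M \<Longrightarrow> window n G i (Suc m) \<subseteq> vspan M T \<Longrightarrow> w \<le> card T"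
  shows "w - m * \<alpha> \<le> num_received P (receiver n i (Suc m))"
proof -
  let ?S = "(stored G)(Node i := {})" and ?R = "received P (receiver n i (Suc m))"
  let ?T = "window n G (Suc i) m"
  \<comment> \<open>Allowing the user edge too lets the same cut lemma serve repair.\<close>
  have P': "is_protocol M (insert (Node i, User i) (ring_edges n)) ?S P"
    using P(1) is_protocol_mono unfolding repair_protocol_def by blast
  have S: "?S (User i) = {}" "\<And>j. j < n \<Longrightarrow> ?S (Node j) \<subseteq> carrier_vec M"
    using node_vectors_carrier[OF G] by (auto simp: stored_def)
  have T: "?T \<subseteq> carrier_vec M" "card ?T \<le> m * \<alpha>"
    using window_carrier[of n G M \<alpha>] card_window_le[of n G M \<alpha>] G \<open>i < n\<close> by auto
  have R: "?T \<union> ?R \<subseteq> carrier_vec M"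
    using T(1) received_carrier[OF P' \<open>i < n\<close> S] by simp
  have nodes: "node_vectors G ((i + a) mod n) \<subseteq> ?T" if "0 < a" "a < Suc m" for a
  proof -
    have "a - 1 < m" "i + a = Suc i + (a - 1)" using that by simp_all
    then show ?thesis unfolding window_def by (metis UN_upper lessThan_iff)
  qed
  have "?S (Node ((i + a) mod n)) \<subseteq> vspan M ?T" if "a < Suc m" for a
  proof (cases a)
    case 0
    then show ?thesis using \<open>i < n\<close> by simp
  next
    case (Suc b)
    then show ?thesis using nodes[of a] that vspan_superset[OF T(1)] by (auto simp: stored_def)
  qed
  from ring_cut[OF P' \<open>i < n\<close> S T(1) this, of "Suc m" 1]
  have "received P (Node i) \<subseteq> vspan M (?T \<union> ?R)" using \<open>i < n\<close> by simp
  then have "node_vectors G i \<subseteq> vspan M (?T \<union> ?R)"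
    using vspan_subset[OF _ R] P(2) unfolding repairs_def by blast
  moreover have "node_vectors G ((i + a) mod n) \<subseteq> vspan M (?T \<union> ?R)" if "0 < a" "a < Suc m" for a
    using nodes[OF that] vspan_superset[OF R] by blast
  ultimately have "window n G i (Suc m) \<subseteq> vspan M (?T \<union> ?R)"
    unfolding window_def using \<open>i < n\<close>
    by (metis (no_types, lifting) UN_least add.right_neutral gr0I lessThan_iff mod_less)
  then have "w \<le> card (?T \<union> ?R)"
    using W R finite_window finite_received by (metis finite_Un)
  also have "\<dots> \<le> card ?T + card ?R" by (rule card_Un_le)
  finally show ?thesis using card_received_le[of P "receiver n i (Suc m)"] T(2) by linarith
qed

theorem theorem4:
  fixes n \<alpha> M i :: nat
    and G :: "nat \<Rightarrow> 'q::{field,finite} mat"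
    and P :: "'q protocol"
  assumes "n \<ge> 2" and "\<alpha> \<ge> 1" and "M \<ge> 1"
    and "ORDSS n \<alpha> M G"
    and "i < n"
    and "repair_protocol n M G i P"
    and "repairs M G i P"
  shows "bandwidth P \<ge> M"
proof -
  define k where "k = nat \<lceil>real M / real \<alpha>\<rceil>"
  have ceil: "real_of_int \<lceil>real M / real \<alpha>\<rceil> = real k"
    unfolding k_def by simp
  have "real M / real \<alpha> \<le> real k" unfolding k_def by (rule real_nat_ceiling_ge)
  then have "real M \<le> real (k * \<alpha>)" using \<open>\<alpha> \<ge> 1\<close> by (simp add: field_simps)
  then have k: "M \<le> k * \<alpha>" by (simp only: of_nat_le_iff)
  have "real k < real M / real \<alpha> + 1" using ceil by linarith
  then have "real (k * \<alpha>) < real (M + \<alpha>)" using \<open>\<alpha> \<ge> 1\<close> by (simp add: field_simps)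
  then have k1: "k * \<alpha> < M + \<alpha>" by (simp only: of_nat_less_iff)
  have G: "G j \<in> carrier_mat M \<alpha>" if "j < n" for j
    using assms(4) that by (simp add: ORDSS_def storage_scheme_def)
  \<comment> \<open>The user at the failed node is chosen, so that its windows start at
    \<open>i\<close>.\<close>
  obtain Q where Q: "reconstruction_protocol n M G i Q" "recovers M i Q"
    and "real (bandwidth Q) = real k * real M - (real k - 1) * real k * real \<alpha> / 2"
    using assms(4) \<open>i < n\<close> unfolding ORDSS_def Let_def ceil by blast
  moreover have "(k - 1) * \<alpha> \<le> M" using k1 by (simp add: diff_mult_distrib)
  ultimately have "real (bandwidth Q) = real (\<Sum>l<k. M - l * \<alpha>)"
    by (subst sum_diff_mult) simp_all
  then have bw: "bandwidth Q = (\<Sum>l<k. M - l * \<alpha>)" by (simp only: of_nat_eq_iff)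
  \<comment> \<open>Here
    \<open>k * \<alpha> < M + \<alpha> \<le> n * \<alpha> + \<alpha>\<close>.\<close>
  have "k * \<alpha> < Suc n * \<alpha>" using k1 data_le_total_storage[OF Q G \<open>i < n\<close>] by simp
  then have "k \<le> n" by (metis mult_less_cancel2 less_Suc_eq_le)
  have "M = min M (k * \<alpha>)" using k by simp
  also have "\<dots> \<le> (\<Sum>m<k. min M (Suc m * \<alpha>) - m * \<alpha>)" by (rule sum_min_diff_ge)
  also have "\<dots> \<le> (\<Sum>m<k. num_received P (receiver n i (Suc m)))"
  proof (rule sum_mono)
    fix m assume "m \<in> {..<k}"
    then show "min M (Suc m * \<alpha>) - m * \<alpha> \<le> num_received P (receiver n i (Suc m))"
      using optimal_window_card_ge[OF Q G \<open>i < n\<close> k \<open>k \<le> n\<close> bw, of _ "Suc m"] \<open>k \<le> n\<close>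
      by (intro repair_received_ge[OF assms(6,7) G \<open>i < n\<close>]) auto
  qed
  also have "\<dots> = (\<Sum>l\<in>Suc ` {..<k}. num_received P (receiver n i l))"
    by (simp add: sum.reindex)
  also have "\<dots> \<le> bandwidth P"
    by (rule sum_receiver_le) (use \<open>k \<le> n\<close> in auto)
  finally show ?thesis .
qed

end
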